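(* Let $\mathbf{A}=(A;\wedge,\vee,\to,\neg,0,\bot,\top)$ be a CNg-algebra, and put $\Diamond x:=x\wedge\top$ and $\Diamond(\mathbf{A}):=(\Diamond[A];\wedge,\vee,\to,0,\top)$. Then $\mathbf{A}$ is isomorphic to a CNg-twist-algebra over $\Diamond(\mathbf{A})$, as witnessed by the map $\iota\colon\mathbf{A}\to\Diamond(\mathbf{A})\times\Diamond(\mathbf{A})$, $a\mapsto(\Diamond a,\Diamond\neg a)$.
   Context: A De Morgan algebra is a bounded distributive lattice $(A;\wedge,\vee,0,1)$ with a unary operation $\neg$ satisfying $\neg\neg a=a$ and $\neg(a\wedge b)=\neg a\vee\neg b$ (so $1=\neg 0$). A DFg-algebra is an algebra $(A;\wedge,\vee,\neg,0,1,\bot,\top)$ such that $(A;\wedge,\vee,\neg,0,1)$ is a De Morgan algebra, $\neg\bot=\bot$, $\neg\top=\top$, and $\bot\wedge\top=0$. A CNg-algebra is a DFg-algebra expanded with a binary operation $\to$ satisfying, with $\Diamond x:=x\wedge\top$: (1) $(x\wedge y)\to z=x\to(y\to z)$; (2) $\top\le x\to(y\to y)$; (3) $\top\le((x\to y)\to x)\to x$; (4) $\Diamond(x\to y)=\Diamond x\to\Diamond y$; (5) $\neg(x\to y)=x\to\neg y$; (6) $\Diamond(x\wedge y)=\Diamond(x\wedge(x\to y))$. $\Diamond(\mathbf{A})$ carries the operations of $\mathbf{A}$ restricted to $\Diamond[A]=\{a\wedge\top:a\in A\}$; it is a Boolean algebra with implication $\to$, least element $0$ and greatest element $\top$. For a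 Boolean algebra $\mathbf{B}$ (with Boolean implication $\to$), the full CNg-twist-algebra $\mathbf{B}^{\bowtie}$ has universe $B\times B$ and operations $(x_1,x_2)\wedge(y_1,y_2):=(x_1\wedge y_1,x_2\vee y_2)$, $\neg(x_1,x_2):=(x_2,x_1)$, $(x_1,x_2)\to(y_1,y_2):=(x_1\to y_1,x_1\to y_2)$, $\top:=(1,1)$, $\bot:=(0,0)$; moreover $x\vee y:=\neg(\neg x\wedge\neg y)$ and the lattice bottom is $(0,1)$. A CNg-twist-algebra over $\mathbf{B}$ is any subalgebra $\mathbf{C}\leqslant\mathbf{B}^{\bowtie}$ such that $\pi_1[C]=B$, where $\pi_1$ is the first projection. *)

theory Defs
  imports "HOL-Algebra.Congruence"
begin

text \<open>All algebras are carrier-based records: the Boolean algebra of an algebra \<open>A\<close> lives on a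
  proper subset of the carrier of \<open>A\<close>, and twist-algebras live on subsets of a product.\<close>

record 'a bd_lattice = "'a partial_object" +
  lmeet :: "'a \<Rightarrow> 'a \<Rightarrow> 'a" (infixl "\<sqinter>\<index>" 70)
  ljoin :: "'a \<Rightarrow> 'a \<Rightarrow> 'a" (infixl "\<squnion>\<index>" 65)
  lzero :: 'a ("\<zero>\<index>")
  lone :: 'a ("\<one>\<index>")

locale bounded_distributive_lattice =
  fixes L (structure)
  assumes meet_closed: "\<lbrakk>x \<in> carrier L; y \<in> carrier L\<rbrakk> \<Longrightarrow> x \<sqinter> y \<in> carrier L"
    and join_closed: "\<lbrakk>x \<in> carrier L; y \<in> carrier L\<rbrakk> \<Longrightarrow> x \<squnion> y \<in> carrier L"
    and zero_closed: "\<zero> \<in> carrier L"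
    and one_closed: "\<one> \<in> carrier L"
    and meet_assoc: "\<lbrakk>x \<in> carrier L; y \<in> carrier L; z \<in> carrier L\<rbrakk>
      \<Longrightarrow> (x \<sqinter> y) \<sqinter> z = x \<sqinter> (y \<sqinter> z)"
    and join_assoc: "\<lbrakk>x \<in> carrier L; y \<in> carrier L; z \<in> carrier L\<rbrakk>
      \<Longrightarrow> (x \<squnion> y) \<squnion> z = x \<squnion> (y \<squnion> z)"
    and meet_commute: "\<lbrakk>x \<in> carrier L; y \<in> carrier L\<rbrakk> \<Longrightarrow> x \<sqinter> y = y \<sqinter> x"
    and join_commute: "\<lbrakk>x \<in> carrier L; y \<in> carrier L\<rbrakk> \<Longrightarrow> x \<squnion> y = y \<squnion> x"
    and meet_join_absorb: "\<lbrakk>x \<in> carrier L; y \<in> carrier L\<rbrakk> \<Longrightarrow> x \<sqinter> (x \<squnion> y) = x"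
    and join_meet_absorb: "\<lbrakk>x \<in> carrier L; y \<in> carrier L\<rbrakk> \<Longrightarrow> x \<squnion> (x \<sqinter> y) = x"
    and meet_join_distrib: "\<lbrakk>x \<in> carrier L; y \<in> carrier L; z \<in> carrier L\<rbrakk>
      \<Longrightarrow> x \<sqinter> (y \<squnion> z) = (x \<sqinter> y) \<squnion> (x \<sqinter> z)"
    and zero_join: "x \<in> carrier L \<Longrightarrow> \<zero> \<squnion> x = x"
    and one_meet: "x \<in> carrier L \<Longrightarrow> \<one> \<sqinter> x = x"

definition lattice_le :: "('a, 'b) bd_lattice_scheme \<Rightarrow> 'a \<Rightarrow> 'a \<Rightarrow> bool" (infix "\<sqsubseteq>\<index>" 50)
  where "x \<sqsubseteq>\<^bsub>L\<^esub> y \<longleftrightarrow> x \<sqinter>\<^bsub>L\<^esub> y = x"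

record 'a bool_algebra = "'a bd_lattice" +
  bimp :: "'a \<Rightarrow> 'a \<Rightarrow> 'a" (infixr "\<hookrightarrow>\<index>" 60)

locale boolean_algebra_imp = bounded_distributive_lattice B
  for B (structure) +
  assumes complemented: "x \<in> carrier B \<Longrightarrow> \<exists>c\<in>carrier B. x \<sqinter> c = \<zero> \<and> x \<squnion> c = \<one>"
    and bimp_complement:
      "\<lbrakk>x \<in> carrier B; y \<in> carrier B; c \<in> carrier B; x \<sqinter> c = \<zero>; x \<squnion> c = \<one>\<rbrakk>
        \<Longrightarrow> x \<hookrightarrow> y = c \<squnion> y"

record 'a demorgan_alg = "'a bd_lattice" +
  neg :: "'a \<Rightarrow> 'a" ("\<sim>\<index> _" [81] 80)

locale De_Morgan_algebra = bounded_distributive_lattice A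
  for A (structure) +
  assumes neg_closed: "x \<in> carrier A \<Longrightarrow> \<sim> x \<in> carrier A"
    and neg_neg: "x \<in> carrier A \<Longrightarrow> \<sim> (\<sim> x) = x"
    and neg_meet: "\<lbrakk>x \<in> carrier A; y \<in> carrier A\<rbrakk> \<Longrightarrow> \<sim> (x \<sqinter> y) = \<sim> x \<squnion> \<sim> y"

text \<open>In the following records \<open>\<bottom>\<close> and \<open>\<top>\<close> are the distinguished constants of the signature;
  the lattice bounds are \<open>\<zero>\<close> and \<open>\<one>\<close>.\<close>

record 'a dfg_alg = "'a demorgan_alg" +
  dbot :: 'a ("\<bottom>\<index>")
  dtop :: 'a ("\<top>\<index>")

locale DFg_algebra = De_Morgan_algebra A
  for A (structure) +
  assumes bot_closed: "\<bottom> \<in> carrier A"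
    and top_closed: "\<top> \<in> carrier A"
    and neg_bot: "\<sim> \<bottom> = \<bottom>"
    and neg_top: "\<sim> \<top> = \<top>"
    and bot_meet_top: "\<bottom> \<sqinter> \<top> = \<zero>"

definition Diamond :: "('a, 'b) dfg_alg_scheme \<Rightarrow> 'a \<Rightarrow> 'a" ("\<diamond>\<index> _" [81] 80)
  where "\<diamond>\<^bsub>A\<^esub> x = x \<sqinter>\<^bsub>A\<^esub> \<top>\<^bsub>A\<^esub>"

record 'a cng_alg = "'a dfg_alg" +
  cimp :: "'a \<Rightarrow> 'a \<Rightarrow> 'a" (infixr "\<leadsto>\<index>" 60)

locale CNg_algebra = DFg_algebra A
  for A (structure) +
  assumes imp_closed: "\<lbrakk>x \<in> carrier A; y \<in> carrier A\<rbrakk> \<Longrightarrow> x \<leadsto> y \<in> carrier A"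
    and meet_imp: "\<lbrakk>x \<in> carrier A; y \<in> carrier A; z \<in> carrier A\<rbrakk>
      \<Longrightarrow> (x \<sqinter> y) \<leadsto> z = x \<leadsto> (y \<leadsto> z)"
    and top_le_imp_self: "\<lbrakk>x \<in> carrier A; y \<in> carrier A\<rbrakk> \<Longrightarrow> \<top> \<sqsubseteq> x \<leadsto> (y \<leadsto> y)"
    and top_le_peirce: "\<lbrakk>x \<in> carrier A; y \<in> carrier A\<rbrakk> \<Longrightarrow> \<top> \<sqsubseteq> ((x \<leadsto> y) \<leadsto> x) \<leadsto> x"
    and Diamond_imp: "\<lbrakk>x \<in> carrier A; y \<in> carrier A\<rbrakk> \<Longrightarrow> \<diamond> (x \<leadsto> y) = (\<diamond> x) \<leadsto> (\<diamond> y)"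
    and neg_imp: "\<lbrakk>x \<in> carrier A; y \<in> carrier A\<rbrakk> \<Longrightarrow> \<sim> (x \<leadsto> y) = x \<leadsto> (\<sim> y)"
    and Diamond_meet_imp: "\<lbrakk>x \<in> carrier A; y \<in> carrier A\<rbrakk>
      \<Longrightarrow> \<diamond> (x \<sqinter> y) = \<diamond> (x \<sqinter> (x \<leadsto> y))"

definition cng_hom :: "('a, 'c) cng_alg_scheme \<Rightarrow> ('b, 'd) cng_alg_scheme \<Rightarrow> ('a \<Rightarrow> 'b) set"
  where "cng_hom A C = {h \<in> carrier A \<rightarrow> carrier C.
    (\<forall>x\<in>carrier A. \<forall>y\<in>carrier A.
        h (x \<sqinter>\<^bsub>A\<^esub> y) = h x \<sqinter>\<^bsub>C\<^esub> h y \<and>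
        h (x \<squnion>\<^bsub>A\<^esub> y) = h x \<squnion>\<^bsub>C\<^esub> h y \<and>
        h (x \<leadsto>\<^bsub>A\<^esub> y) = h x \<leadsto>\<^bsub>C\<^esub> h y) \<and>
    (\<forall>x\<in>carrier A. h (\<sim>\<^bsub>A\<^esub> x) = \<sim>\<^bsub>C\<^esub> (h x)) \<and>
    h \<zero>\<^bsub>A\<^esub> = \<zero>\<^bsub>C\<^esub> \<and> h \<one>\<^bsub>A\<^esub> = \<one>\<^bsub>C\<^esub> \<and> h \<bottom>\<^bsub>A\<^esub> = \<bottom>\<^bsub>C\<^esub> \<and> h \<top>\<^bsub>A\<^esub> = \<top>\<^bsub>C\<^esub>}"

definition cng_iso :: "('a, 'c) cng_alg_scheme \<Rightarrow> ('b, 'd) cng_alg_scheme \<Rightarrow> ('a \<Rightarrow> 'b) set"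
  where "cng_iso A C = {h \<in> cng_hom A C. bij_betw h (carrier A) (carrier C)}"

text \<open>As for subgroups in HOL-Algebra, a subalgebra is given by its universe \<open>H\<close>; the algebra itself
  is \<open>S\<lparr>carrier := H\<rparr>\<close>.\<close>

locale cng_subalgebra =
  fixes H :: "'a set" and S :: "('a, 'b) cng_alg_scheme" (structure)
  assumes subset: "H \<subseteq> carrier S"
    and sub_meet: "\<lbrakk>x \<in> H; y \<in> H\<rbrakk> \<Longrightarrow> x \<sqinter> y \<in> H"
    and sub_join: "\<lbrakk>x \<in> H; y \<in> H\<rbrakk> \<Longrightarrow> x \<squnion> y \<in> H"
    and sub_imp: "\<lbrakk>x \<in> H; y \<in> H\<rbrakk> \<Longrightarrow> x \<leadsto> y \<in> H"
    and sub_neg: "x \<in> H \<Longrightarrow> \<sim> x \<in> H"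
    and sub_zero: "\<zero> \<in> H"
    and sub_one: "\<one> \<in> H"
    and sub_bot: "\<bottom> \<in> H"
    and sub_top: "\<top> \<in> H"

definition Diamond_algebra :: "('a, 'b) cng_alg_scheme \<Rightarrow> 'a bool_algebra"
  where "Diamond_algebra A =
    \<lparr>carrier = Diamond A ` carrier A, lmeet = lmeet A, ljoin = ljoin A,
     lzero = \<zero>\<^bsub>A\<^esub>, lone = \<top>\<^bsub>A\<^esub>, bimp = cimp A\<rparr>"

definition twist_neg :: "'a \<times> 'a \<Rightarrow> 'a \<times> 'a"
  where "twist_neg = (\<lambda>(x1, x2). (x2, x1))"

definition twist_meet :: "('a, 'b) bool_algebra_scheme \<Rightarrow> 'a \<times> 'a \<Rightarrow> 'a \<times> 'a \<Rightarrow> 'a \<times> 'a"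
  where "twist_meet B = (\<lambda>(x1, x2) (y1, y2). (x1 \<sqinter>\<^bsub>B\<^esub> y1, x2 \<squnion>\<^bsub>B\<^esub> y2))"

definition full_twist :: "('a, 'b) bool_algebra_scheme \<Rightarrow> ('a \<times> 'a) cng_alg"
  where "full_twist B =
    \<lparr>carrier = carrier B \<times> carrier B,
     lmeet = twist_meet B,
     ljoin = (\<lambda>x y. twist_neg (twist_meet B (twist_neg x) (twist_neg y))),
     lzero = (\<zero>\<^bsub>B\<^esub>, \<one>\<^bsub>B\<^esub>),
     lone = twist_neg (\<zero>\<^bsub>B\<^esub>, \<one>\<^bsub>B\<^esub>),
     neg = twist_neg,
     dbot = (\<zero>\<^bsub>B\<^esub>, \<zero>\<^bsub>B\<^esub>),
     dtop = (\<one>\<^bsub>B\<^esub>, \<one>\<^bsub>B\<^esub>),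
     cimp = (\<lambda>(x1, x2) (y1, y2). (x1 \<hookrightarrow>\<^bsub>B\<^esub> y1, x1 \<hookrightarrow>\<^bsub>B\<^esub> y2))\<rparr>"

locale CNg_twist_algebra =
  boolean_algebra_imp B + cng_subalgebra C "full_twist B"
  for C :: "('a \<times> 'a) set" and B :: "('a, 'b) bool_algebra_scheme" (structure) +
  assumes fst_image: "fst ` C = carrier B"

definition twist_embedding :: "('a, 'b) cng_alg_scheme \<Rightarrow> 'a \<Rightarrow> 'a \<times> 'a" ("\<iota>\<index>")
  where "\<iota>\<^bsub>A\<^esub> = (\<lambda>a. (\<diamond>\<^bsub>A\<^esub> a, \<diamond>\<^bsub>A\<^esub> (\<sim>\<^bsub>A\<^esub> a)))"

end

theory Submission
  imports Defs
begin

text \<open>The principal ideal \<open>[\<zero>, \<top>]\<close> of a CNg-algebra \<open>A\<close> is exactly the range of \<open>\<diamond>\<close>, and there the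
  axioms lose their modal guards: \<open>x \<leadsto> (y \<leadsto> y)\<close> and Peirce's formula become equal to \<open>\<top>\<close>, and
  \<open>x \<sqinter> y = x \<sqinter> (x \<leadsto> y)\<close>. Together with currying, these laws make \<open>\<leadsto>\<close> the residual of \<open>\<sqinter>\<close>, so
  that \<open>[\<zero>, \<top>]\<close> is a Heyting algebra; Peirce's law then turns it into a Boolean algebra whose
  implication is \<open>\<leadsto>\<close> (\<open>peircean_lattice_is_boolean\<close>, \<open>Diamond_algebra_boolean\<close>).

  The map \<open>\<iota>\<close> is a homomorphism because \<open>\<diamond>\<close> preserves \<open>\<sqinter>\<close>, \<open>\<squnion>\<close> and \<open>\<leadsto>\<close>, while \<open>\<sim>\<close> exchanges \<open>\<sqinter>\<close>
  and \<open>\<squnion>\<close> and passes to the consequent of an implication, just as the exchange of coordinates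
  does. It is injective because \<open>\<diamond> (\<sim> a)\<close> is the negation of \<open>a \<squnion> \<top>\<close>, and in a distributive lattice
  an element \<open>a\<close> is determined by \<open>a \<sqinter> \<top>\<close> and \<open>a \<squnion> \<top>\<close>. Hence \<open>A\<close> is isomorphic to its image
  under \<open>\<iota>\<close>, whose first projection is the whole range of \<open>\<diamond>\<close>.\<close>

section \<open>Order and cancellation in bounded distributive lattices\<close>

context bounded_distributive_lattice
begin

lemma meet_idem: "x \<in> carrier L \<Longrightarrow> x \<sqinter> x = x"
  by (metis join_meet_absorb meet_closed meet_join_absorb)

lemma le_refl: "x \<in> carrier L \<Longrightarrow> x \<sqsubseteq> x"
  by (simp add: lattice_le_def meet_idem)

lemma le_antisym:
  "\<lbrakk>x \<in> carrier L; y \<in> carrier L; x \<sqsubseteq> y; y \<sqsubseteq> x\<rbrakk> \<Longrightarrow> x = y"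
  by (metis lattice_le_def meet_commute)

lemma le_trans:
  "\<lbrakk>x \<in> carrier L; y \<in> carrier L; z \<in> carrier L; x \<sqsubseteq> y; y \<sqsubseteq> z\<rbrakk> \<Longrightarrow> x \<sqsubseteq> z"
  by (metis lattice_le_def meet_assoc)

lemma meet_le1: "\<lbrakk>x \<in> carrier L; y \<in> carrier L\<rbrakk> \<Longrightarrow> x \<sqinter> y \<sqsubseteq> x"
  by (metis lattice_le_def meet_assoc meet_commute meet_idem)

lemma meet_le2: "\<lbrakk>x \<in> carrier L; y \<in> carrier L\<rbrakk> \<Longrightarrow> x \<sqinter> y \<sqsubseteq> y"
  by (metis meet_commute meet_le1)

lemma le_join1: "\<lbrakk>x \<in> carrier L; y \<in> carrier L\<rbrakk> \<Longrightarrow> x \<sqsubseteq> x \<squnion> y"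
  by (simp add: lattice_le_def meet_join_absorb)

lemma le_join2: "\<lbrakk>x \<in> carrier L; y \<in> carrier L\<rbrakk> \<Longrightarrow> y \<sqsubseteq> x \<squnion> y"
  by (metis join_commute le_join1)

lemma join_least:
  "\<lbrakk>x \<in> carrier L; y \<in> carrier L; z \<in> carrier L; x \<sqsubseteq> z; y \<sqsubseteq> z\<rbrakk> \<Longrightarrow> x \<squnion> y \<sqsubseteq> z"
  by (metis join_closed lattice_le_def meet_commute meet_join_distrib)

lemma join_meet_distrib2:
  "\<lbrakk>x \<in> carrier L; y \<in> carrier L; z \<in> carrier L\<rbrakk> \<Longrightarrow> (x \<squnion> y) \<sqinter> z = (x \<sqinter> z) \<squnion> (y \<sqinter> z)"
  by (metis join_closed meet_commute meet_join_distrib)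

lemma zero_meet: "x \<in> carrier L \<Longrightarrow> \<zero> \<sqinter> x = \<zero>"
  by (metis meet_join_absorb zero_closed zero_join)

lemma meet_one: "x \<in> carrier L \<Longrightarrow> x \<sqinter> \<one> = x"
  by (metis meet_commute one_closed one_meet)

lemma meet_join_cancel:
  assumes "x \<in> carrier L" "y \<in> carrier L" "z \<in> carrier L"
    and "x \<sqinter> z = y \<sqinter> z" "x \<squnion> z = y \<squnion> z"
  shows "x = y"
  using assms by (metis join_meet_absorb join_commute meet_commute meet_closed
      meet_join_absorb meet_join_distrib)

text \<open>A principal ideal is a lattice in its own right, with its generator as greatest element.
  Another record \<open>B\<close> is used because it may carry a different signature from \<open>L\<close>.\<close>

lemma principal_ideal_lattice:
  fixes B :: "('a, 'c) bd_lattice_scheme"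
  assumes t: "t \<in> carrier L"
    and carrier_B: "carrier B = (\<lambda>x. x \<sqinter> t) ` carrier L"
    and ops: "lmeet B = lmeet L" "ljoin B = ljoin L" "\<zero>\<^bsub>B\<^esub> = \<zero>" "\<one>\<^bsub>B\<^esub> = t"
  shows "bounded_distributive_lattice B"
proof -
  have mem: "x \<in> carrier B \<longleftrightarrow> x \<in> carrier L \<and> x \<sqinter> t = x" for x
    using t by (auto simp: carrier_B meet_closed meet_assoc meet_idem intro!: image_eqI[of x _ x])
  show ?thesis
  proof
    fix x y z
    assume "x \<in> carrier B" "y \<in> carrier B" "z \<in> carrier B"
    then show "x \<sqinter>\<^bsub>B\<^esub> (y \<squnion>\<^bsub>B\<^esub> z) = x \<sqinter>\<^bsub>B\<^esub> y \<squnion>\<^bsub>B\<^esub> x \<sqinter>\<^bsub>B\<^esub> z"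
      by (simp add: ops mem meet_join_distrib)
  qed (use t in \<open>simp_all add: ops mem meet_closed join_closed zero_closed meet_assoc join_assoc
      join_meet_distrib2 zero_meet meet_idem meet_join_absorb join_meet_absorb zero_join,
      (metis meet_commute join_commute)+\<close>)
qed

end

section \<open>Peirce's law and Boolean implication\<close>

locale peircean_lattice = bounded_distributive_lattice B
  for B (structure) +
  assumes imp_closed: "\<lbrakk>x \<in> carrier B; y \<in> carrier B\<rbrakk> \<Longrightarrow> x \<hookrightarrow> y \<in> carrier B"
    and curry: "\<lbrakk>x \<in> carrier B; y \<in> carrier B; z \<in> carrier B\<rbrakk>
      \<Longrightarrow> (x \<sqinter> y) \<hookrightarrow> z = x \<hookrightarrow> (y \<hookrightarrow> z)"
    and imp_imp_self: "\<lbrakk>x \<in> carrier B; y \<in> carrier B\<rbrakk> \<Longrightarrow> x \<hookrightarrow> (y \<hookrightarrow> y) = \<one>"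
    and peirce: "\<lbrakk>x \<in> carrier B; y \<in> carrier B\<rbrakk> \<Longrightarrow> ((x \<hookrightarrow> y) \<hookrightarrow> x) \<hookrightarrow> x = \<one>"
    and meet_imp_eq: "\<lbrakk>x \<in> carrier B; y \<in> carrier B\<rbrakk> \<Longrightarrow> x \<sqinter> (x \<hookrightarrow> y) = x \<sqinter> y"
begin

lemma one_imp: "x \<in> carrier B \<Longrightarrow> \<one> \<hookrightarrow> x = x"
  by (metis imp_closed meet_imp_eq one_closed one_meet)

lemma le_iff_imp_eq_one:
  assumes x: "x \<in> carrier B" and y: "y \<in> carrier B"
  shows "x \<sqsubseteq> y \<longleftrightarrow> x \<hookrightarrow> y = \<one>"
proof
  assume "x \<sqsubseteq> y"
  then have "x \<hookrightarrow> y = (x \<sqinter> y) \<hookrightarrow> y" by (simp add: lattice_le_def)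
  also have "\<dots> = \<one>" using x y by (simp add: curry imp_imp_self)
  finally show "x \<hookrightarrow> y = \<one>" .
next
  assume "x \<hookrightarrow> y = \<one>"
  then show "x \<sqsubseteq> y" using meet_imp_eq[OF x y] x by (simp add: lattice_le_def meet_one)
qed

text \<open>Since \<open>\<hookrightarrow>\<close> internalises the order, currying is residuation.\<close>

lemma residuation:
  assumes "x \<in> carrier B" "y \<in> carrier B" "z \<in> carrier B"
  shows "z \<sqinter> x \<sqsubseteq> y \<longleftrightarrow> z \<sqsubseteq> x \<hookrightarrow> y"
  using assms by (simp add: le_iff_imp_eq_one meet_closed imp_closed curry)

lemma meet_imp_zero: "x \<in> carrier B \<Longrightarrow> x \<sqinter> (x \<hookrightarrow> \<zero>) = \<zero>"
  by (metis meet_imp_eq meet_commute zero_closed zero_meet)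

text \<open>Excluded middle holds because the negation of \<open>z = x \<squnion> (x \<hookrightarrow> \<zero>)\<close> lies below \<open>z\<close>: it entails the
  negation of \<open>x\<close>, which is a disjunct of \<open>z\<close>. Peirce's law makes every element above its own
  negation equal to \<open>\<one>\<close>.\<close>

lemma join_imp_zero:
  assumes x: "x \<in> carrier B"
  shows "x \<squnion> (x \<hookrightarrow> \<zero>) = \<one>"
proof -
  define c where "c = x \<hookrightarrow> \<zero>"
  define z where "z = x \<squnion> c"
  define d where "d = z \<hookrightarrow> \<zero>"
  have closed: "c \<in> carrier B" "z \<in> carrier B" "d \<in> carrier B"
    using x by (simp_all add: c_def z_def d_def imp_closed join_closed zero_closed)
  have "d \<sqinter> z \<sqsubseteq> \<zero>"
    using closed by (simp add: residuation zero_closed d_def le_refl)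
  then have "d \<sqinter> z = \<zero>"
    using closed by (metis lattice_le_def meet_closed meet_commute zero_closed zero_meet)
  moreover have "x \<sqinter> z = x" using x closed by (simp add: z_def meet_join_absorb)
  ultimately have "d \<sqinter> x = \<zero>"
    using x closed by (metis meet_assoc meet_commute zero_meet)
  then have "d \<sqsubseteq> c"
    using x closed by (simp add: c_def residuation[symmetric] zero_closed le_refl)
  then have "d \<sqsubseteq> z"
    using x closed le_trans[OF _ _ _ _ le_join2[of x c]] by (simp add: z_def)
  then have "d \<hookrightarrow> z = \<one>" using closed by (simp add: le_iff_imp_eq_one)
  then have "z = \<one>"
    using closed peirce[of z \<zero>] by (simp add: d_def zero_closed one_imp)
  then show ?thesis by (simp add: z_def c_def)
qed

lemma imp_eq_complement_join:
  assumes x: "x \<in> carrier B" and y: "y \<in> carrier B" and c: "c \<in> carrier B"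
    and meet: "x \<sqinter> c = \<zero>" and join: "x \<squnion> c = \<one>"
  shows "x \<hookrightarrow> y = c \<squnion> y"
proof (rule le_antisym)
  let ?w = "x \<hookrightarrow> y"
  show w: "?w \<in> carrier B" and cy: "c \<squnion> y \<in> carrier B"
    using x y c by (simp_all add: imp_closed join_closed)
  have "?w = ?w \<sqinter> (x \<squnion> c)" using w by (simp add: join meet_one)
  then have split: "?w = (?w \<sqinter> x) \<squnion> (?w \<sqinter> c)" using w x c by (simp add: meet_join_distrib)
  have "?w \<sqinter> x \<sqsubseteq> y" using x y w by (simp add: residuation le_refl)
  then have "?w \<sqinter> x \<sqsubseteq> c \<squnion> y"
    using le_trans[OF meet_closed[OF w x] y cy _ le_join2[OF c y]] by simp
  moreover have "?w \<sqinter> c \<sqsubseteq> c \<squnion> y"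
    using le_trans[OF meet_closed[OF w c] c cy meet_le2[OF w c] le_join1[OF c y]] .
  ultimately show "?w \<sqsubseteq> c \<squnion> y"
    using join_least[OF meet_closed[OF w x] meet_closed[OF w c] cy] split by simp
  have "c \<sqinter> x = \<zero>" using meet x c meet_commute by metis
  then have "(c \<squnion> y) \<sqinter> x = y \<sqinter> x"
    using x y c by (simp add: join_meet_distrib2 zero_join meet_closed)
  then have "(c \<squnion> y) \<sqinter> x \<sqsubseteq> y" using x y by (simp add: meet_le1)
  then show "c \<squnion> y \<sqsubseteq> ?w" using x y cy by (simp add: residuation)
qed

lemma peircean_lattice_is_boolean: "boolean_algebra_imp B"
  by unfold_locales
    (blast intro: meet_imp_zero join_imp_zero imp_closed zero_closed, rule imp_eq_complement_join)

end

section \<open>The Boolean algebra below the designated top\<close>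

context CNg_algebra
begin

lemma Diamond_closed: "x \<in> carrier A \<Longrightarrow> \<diamond> x \<in> carrier A"
  by (simp add: Diamond_def meet_closed top_closed)

lemma Diamond_idem: "x \<in> carrier A \<Longrightarrow> \<diamond> (\<diamond> x) = \<diamond> x"
  by (simp add: Diamond_def meet_assoc meet_idem top_closed)

lemma Diamond_meet:
  "\<lbrakk>x \<in> carrier A; y \<in> carrier A\<rbrakk> \<Longrightarrow> \<diamond> (x \<sqinter> y) = \<diamond> x \<sqinter> \<diamond> y"
  unfolding Diamond_def by (metis meet_assoc meet_closed meet_commute meet_idem top_closed)

lemma Diamond_join:
  "\<lbrakk>x \<in> carrier A; y \<in> carrier A\<rbrakk> \<Longrightarrow> \<diamond> (x \<squnion> y) = \<diamond> x \<squnion> \<diamond> y"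
  by (simp add: Diamond_def join_meet_distrib2 top_closed)

lemma neg_join: "\<lbrakk>x \<in> carrier A; y \<in> carrier A\<rbrakk> \<Longrightarrow> \<sim> (x \<squnion> y) = \<sim> x \<sqinter> \<sim> y"
  by (metis meet_closed neg_closed neg_meet neg_neg)

lemma neg_zero: "\<sim> \<zero> = \<one>"
  by (metis join_meet_absorb neg_closed neg_neg neg_join one_closed one_meet meet_one zero_closed
      zero_join)

lemma Diamond_image_iff: "x \<in> Diamond A ` carrier A \<longleftrightarrow> x \<in> carrier A \<and> \<diamond> x = x"
  by (auto simp: Diamond_closed Diamond_idem intro!: image_eqI[of x _ x])

lemma Diamond_eq_top: "\<lbrakk>x \<in> carrier A; \<top> \<sqsubseteq> x\<rbrakk> \<Longrightarrow> \<diamond> x = \<top>"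
  by (metis Diamond_def lattice_le_def meet_commute top_closed)

text \<open>On fixed points of \<open>\<diamond>\<close> an inequality \<open>\<top> \<sqsubseteq> x\<close> is the equation \<open>x = \<top>\<close>, and the outer \<open>\<diamond>\<close> of
  the axiom \<open>\<diamond> (x \<sqinter> y) = \<diamond> (x \<sqinter> (x \<leadsto> y))\<close> can be dropped. The set of fixed points is closed under
  \<open>\<leadsto>\<close> because \<open>\<diamond>\<close> commutes with it.\<close>

lemma Diamond_algebra_boolean: "boolean_algebra_imp (Diamond_algebra A)"
proof -
  let ?D = "Diamond_algebra A"
  have mem: "x \<in> carrier ?D \<longleftrightarrow> x \<in> carrier A \<and> \<diamond> x = x" for x
    by (simp add: Diamond_algebra_def Diamond_image_iff)
  have ops: "lmeet ?D = lmeet A" "ljoin ?D = ljoin A" "\<zero>\<^bsub>?D\<^esub> = \<zero>" "\<one>\<^bsub>?D\<^esub> = \<top>"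
    "bimp ?D = cimp A"
    by (simp_all add: Diamond_algebra_def)
  have "carrier ?D = (\<lambda>x. x \<sqinter> \<top>) ` carrier A"
    by (simp add: Diamond_algebra_def Diamond_def)
  then interpret D: bounded_distributive_lattice ?D
    by (rule principal_ideal_lattice[OF top_closed]) (simp_all add: ops)
  have "peircean_lattice ?D"
  proof
    fix x y z
    assume x: "x \<in> carrier ?D" and y: "y \<in> carrier ?D"
    show "x \<hookrightarrow>\<^bsub>?D\<^esub> y \<in> carrier ?D"
      using x y by (simp add: mem ops imp_closed Diamond_imp)
    show "x \<hookrightarrow>\<^bsub>?D\<^esub> (y \<hookrightarrow>\<^bsub>?D\<^esub> y) = \<one>\<^bsub>?D\<^esub>"
      using x y Diamond_eq_top[OF _ top_le_imp_self, of x y]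
      by (simp add: mem ops imp_closed Diamond_imp)
    show "((x \<hookrightarrow>\<^bsub>?D\<^esub> y) \<hookrightarrow>\<^bsub>?D\<^esub> x) \<hookrightarrow>\<^bsub>?D\<^esub> x = \<one>\<^bsub>?D\<^esub>"
      using x y Diamond_eq_top[OF _ top_le_peirce, of x y]
      by (simp add: mem ops imp_closed Diamond_imp)
    show "x \<sqinter>\<^bsub>?D\<^esub> (x \<hookrightarrow>\<^bsub>?D\<^esub> y) = x \<sqinter>\<^bsub>?D\<^esub> y"
      using x y Diamond_meet_imp[of x y]
      by (simp add: mem ops imp_closed Diamond_imp Diamond_meet)
    assume z: "z \<in> carrier ?D"
    show "(x \<sqinter>\<^bsub>?D\<^esub> y) \<hookrightarrow>\<^bsub>?D\<^esub> z = x \<hookrightarrow>\<^bsub>?D\<^esub> (y \<hookrightarrow>\<^bsub>?D\<^esub> z)"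
      using x y z by (simp add: mem ops meet_imp)
  qed
  then show ?thesis by (rule peircean_lattice.peircean_lattice_is_boolean)
qed

section \<open>The twist embedding\<close>

text \<open>Negating \<open>\<diamond> (\<sim> x) = \<diamond> (\<sim> y)\<close> gives \<open>x \<squnion> \<top> = y \<squnion> \<top>\<close>, as \<open>\<top>\<close> is its own negation; so the two
  coordinates supply the two hypotheses of cancellation at \<open>\<top>\<close>.\<close>

lemma twist_embedding_inj: "inj_on \<iota> (carrier A)"
proof (rule inj_onI)
  fix x y
  assume x: "x \<in> carrier A" and y: "y \<in> carrier A" and "\<iota> x = \<iota> y"
  then have meets: "x \<sqinter> \<top> = y \<sqinter> \<top>" "\<sim> x \<sqinter> \<top> = \<sim> y \<sqinter> \<top>"
    by (simp_all add: twist_embedding_def Diamond_def)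
  have "\<sim> (\<sim> u \<sqinter> \<top>) = u \<squnion> \<top>" if "u \<in> carrier A" for u
    using that by (simp add: neg_meet neg_closed neg_neg top_closed neg_top)
  then have "x \<squnion> \<top> = y \<squnion> \<top>" using meets(2) x y by metis
  with meets(1) show "x = y" using meet_join_cancel x y top_closed by blast
qed

lemma twist_embedding_hom: "\<iota> \<in> cng_hom A (full_twist (Diamond_algebra A))"
  by (simp add: cng_hom_def full_twist_def Diamond_algebra_def twist_embedding_def twist_meet_def
      twist_neg_def Diamond_meet Diamond_join Diamond_imp neg_meet neg_join neg_imp neg_neg neg_closed)
    (metis Diamond_def bot_meet_top meet_idem neg_bot neg_neg neg_top neg_zero one_closed one_meet
      top_closed zero_closed zero_meet)

end

text \<open>The image of a homomorphism is a subalgebra, since every operation applied to values \<open>h x\<close> is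
  again a value of \<open>h\<close>.\<close>

lemma cng_hom_image_subalgebra:
  assumes "CNg_algebra A" and h: "h \<in> cng_hom A S"
  shows "cng_subalgebra (h ` carrier A) S"
proof -
  interpret CNg_algebra A by fact
  show ?thesis
    using h unfolding cng_hom_def
    by unfold_locales
      (auto simp: image_iff, (metis meet_closed join_closed imp_closed neg_closed zero_closed
        one_closed bot_closed top_closed)+)
qed

lemma cng_hom_iso_image:
  assumes "h \<in> cng_hom A S" and "inj_on h (carrier A)"
  shows "h \<in> cng_iso A (S\<lparr>carrier := h ` carrier A\<rparr>)"
  using assms by (simp add: cng_iso_def cng_hom_def bij_betw_def)

theorem theorem48:
  fixes A :: "('a, 'b) cng_alg_scheme"
  assumes "CNg_algebra A"
  shows "\<exists>C. CNg_twist_algebra C (Diamond_algebra A) \<and>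
    \<iota>\<^bsub>A\<^esub> \<in> cng_iso A ((full_twist (Diamond_algebra A))\<lparr>carrier := C\<rparr>)"
proof -
  interpret CNg_algebra A by fact
  let ?C = "\<iota>\<^bsub>A\<^esub> ` carrier A"
  have "fst ` ?C = carrier (Diamond_algebra A)"
    by (simp add: image_image twist_embedding_def Diamond_algebra_def)
  then have "CNg_twist_algebra ?C (Diamond_algebra A)"
    by (simp add: CNg_twist_algebra_def CNg_twist_algebra_axioms_def Diamond_algebra_boolean
        cng_hom_image_subalgebra[OF assms twist_embedding_hom])
  moreover have "\<iota>\<^bsub>A\<^esub> \<in> cng_iso A ((full_twist (Diamond_algebra A))\<lparr>carrier := ?C\<rparr>)"
    by (rule cng_hom_iso_image[OF twist_embedding_hom twist_embedding_inj])
  ultimately show ?thesis by blast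
qed

end
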